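(* Let $(X,p)$ be a complete TVS-cone metric space over a cone $P$ in a real Hausdorff locally convex topological vector space $E$, let $e\in\operatorname{int}P$, and let $T:X\to X$ be a mapping satisfying $p(Tx,Ty)\le\varphi(p(x,y))$ for all $x,y\in X$, where $\varphi:P\to P$ is increasing, $\varphi(re)\le r\varphi(e)$ for every real number $r\ge 0$, and $\xi_e(\varphi(e))<1$. Then $T$ has a unique fixed point, say $u$, and $T^nx\to u$ as $n\to\infty$ for all $x\in X$.
   Context: A cone is a non-empty subset $P\subset E$ with $P+P\subset P$, $\lambda P\subset P$ for all $\lambda\ge 0$, and $P\cap(-P)=\{0\}$; $P$ is always assumed closed with nonempty interior $\operatorname{int}P$. Write $x\le y$ iff $y-x\in P$, and $x\ll y$ iff $y-x\in\operatorname{int}P$. A TVS-cone metric space (TVS-CMS) $(X,p)$ over $P$ is a non-empty set $X$ with a map $p:X\times X\to E$ such that for all $x,y,z\in X$: $0\le p(x,y)$; $p(x,y)=0$ iff $x=y$; $p(x,y)=p(y,x)$; $p(x,y)\le p(x,z)+p(z,y)$. A sequence $\{x_n\}$ in $X$ converges to $x$ if for every $c\gg 0$ there is $M$ with $p(x_n,x)\ll c$ for all $n\ge M$; it is Cauchy if for every $c\gg0$ there is $M$ with $p(x_n,x_m)\ll c$ for all $n,m\ge M$; $(X,p)$ is complete if every Cauchy sequence converges. For $e\in\operatorname{int}P$ the nonlinear scalarization function $\xi_e:E\to\mathbb{R}$ is $\xi_e(y)=\inf\{t\in\mathbb{R}: y\in te-P\}$. "Increasing" means order-preserving ($u\le v$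 implies $\varphi(u)\le\varphi(v)$). *)

theory Defs
  imports "HOL-Analysis.Analysis"
begin

class topological_real_vector = real_vector + topological_ab_group_add +
  assumes tendsto_scaleR_nhds:
    "((\<lambda>(r, x). r *\<^sub>R x) \<longlongrightarrow> a *\<^sub>R b) (nhds (a::real) \<times>\<^sub>F nhds b)"

(* The third conjunct is "convex V"; that constant cannot be used in a class axiom. *)
class locally_convex_space = topological_real_vector +
  assumes locally_convex_at_0_unfolded:
    "\<lbrakk>open U; 0 \<in> U\<rbrakk> \<Longrightarrow>
       \<exists>V. open V \<and> 0 \<in> V \<and>
         (\<forall>x\<in>V. \<forall>y\<in>V. \<forall>u\<ge>0. \<forall>v\<ge>0. u + v = 1 \<longrightarrow> u *\<^sub>R x + v *\<^sub>R y \<in> V) \<and>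
         V \<subseteq> U"

lemma locally_convex_at_0:
  fixes U :: "'a::locally_convex_space set"
  assumes "open U" "0 \<in> U"
  shows "\<exists>V. open V \<and> 0 \<in> V \<and> convex V \<and> V \<subseteq> U"
  unfolding convex_def by (rule locally_convex_at_0_unfolded[OF assms])

(* Every real normed space belongs to the classes just defined. *)
instance real_normed_vector \<subseteq> locally_convex_space
proof
  fix a :: real and b :: 'a
  have "((\<lambda>z. fst z *\<^sub>R snd z) \<longlongrightarrow> a *\<^sub>R b) (nhds a \<times>\<^sub>F nhds b)"
    by (intro tendsto_scaleR filterlim_fst filterlim_snd)
  then show "((\<lambda>(r, x). r *\<^sub>R x) \<longlongrightarrow> a *\<^sub>R b) (nhds a \<times>\<^sub>F nhds b)"
    by (simp add: case_prod_beta')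
next
  fix U :: "'a set"
  assume "open U" "0 \<in> U"
  then obtain r where "r > 0" "ball 0 r \<subseteq> U"
    by (meson open_contains_ball)
  moreover have "convex (ball (0::'a) r)"
    by (rule convex_ball)
  ultimately show "\<exists>V. open V \<and> 0 \<in> V \<and>
      (\<forall>x\<in>V. \<forall>y\<in>V. \<forall>u\<ge>0. \<forall>v\<ge>0. u + v = 1 \<longrightarrow> u *\<^sub>R x + v *\<^sub>R y \<in> V) \<and>
      V \<subseteq> U"
    unfolding convex_def by (intro exI[of _ "ball 0 r"] conjI) auto
qed

(* The library predicate "cone" is closure under multiplication by nonnegative
   scalars only; "tvs_cone" is the closed, solid, pointed convex cone used as the
   value set of a cone metric. *)
definition tvs_cone :: "'e::topological_real_vector set \<Rightarrow> bool" where
  "tvs_cone P \<longleftrightarrow>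
     P \<noteq> {} \<and>
     (\<forall>x\<in>P. \<forall>y\<in>P. x + y \<in> P) \<and>
     cone P \<and>
     P \<inter> uminus ` P = {0} \<and>
     closed P \<and>
     interior P \<noteq> {}"

definition cone_le :: "'e::topological_real_vector set \<Rightarrow> 'e \<Rightarrow> 'e \<Rightarrow> bool" where
  "cone_le P x y \<longleftrightarrow> y - x \<in> P"

definition cone_ll :: "'e::topological_real_vector set \<Rightarrow> 'e \<Rightarrow> 'e \<Rightarrow> bool" where
  "cone_ll P x y \<longleftrightarrow> y - x \<in> interior P"

locale tvs_cone_metric_space =
  fixes P :: "'e::{locally_convex_space, t2_space} set"
    and X :: "'a set"
    and p :: "'a \<Rightarrow> 'a \<Rightarrow> 'e"
  assumes tvs_cone: "tvs_cone P"
    and nonempty: "X \<noteq> {}"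
    and nonneg: "\<lbrakk>x \<in> X; y \<in> X\<rbrakk> \<Longrightarrow> cone_le P 0 (p x y)"
    and eq_0_iff: "\<lbrakk>x \<in> X; y \<in> X\<rbrakk> \<Longrightarrow> p x y = 0 \<longleftrightarrow> x = y"
    and commute: "\<lbrakk>x \<in> X; y \<in> X\<rbrakk> \<Longrightarrow> p x y = p y x"
    and triangle:
      "\<lbrakk>x \<in> X; y \<in> X; z \<in> X\<rbrakk> \<Longrightarrow> cone_le P (p x y) (p x z + p z y)"

definition cone_converges ::
  "'e::topological_real_vector set \<Rightarrow> ('a \<Rightarrow> 'a \<Rightarrow> 'e) \<Rightarrow> (nat \<Rightarrow> 'a) \<Rightarrow> 'a \<Rightarrow> bool" where
  "cone_converges P p s x \<longleftrightarrow>
     (\<forall>c. cone_ll P 0 c \<longrightarrow> (\<exists>M. \<forall>n\<ge>M. cone_ll P (p (s n) x) c))"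

definition cone_Cauchy ::
  "'e::topological_real_vector set \<Rightarrow> ('a \<Rightarrow> 'a \<Rightarrow> 'e) \<Rightarrow> (nat \<Rightarrow> 'a) \<Rightarrow> bool" where
  "cone_Cauchy P p s \<longleftrightarrow>
     (\<forall>c. cone_ll P 0 c \<longrightarrow> (\<exists>M. \<forall>n\<ge>M. \<forall>m\<ge>M. cone_ll P (p (s n) (s m)) c))"

definition cone_complete ::
  "'e::topological_real_vector set \<Rightarrow> 'a set \<Rightarrow> ('a \<Rightarrow> 'a \<Rightarrow> 'e) \<Rightarrow> bool" where
  "cone_complete P X p \<longleftrightarrow>
     (\<forall>s. range s \<subseteq> X \<and> cone_Cauchy P p s \<longrightarrow> (\<exists>x\<in>X. cone_converges P p s x))"

(* The infimum is over a nonempty set bounded below whenever "e" is interior to a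
   "tvs_cone" and the space is nontrivial; in the zero space it is an infimum over
   all reals and hence unspecified. *)
definition scalarization :: "'e::topological_real_vector set \<Rightarrow> 'e \<Rightarrow> 'e \<Rightarrow> real" where
  "scalarization P e y = Inf {t. y \<in> (\<lambda>q. t *\<^sub>R e - q) ` P}"

end

theory Submission
  imports Defs
begin

text \<open>
  A cone metric with values in a solid closed cone is, for every question about convergence, an
  ordinary metric.  Fix \<open>e\<close> in the interior of \<open>P\<close> and let \<open>gauge y\<close> be the least \<open>t \<ge> 0\<close> with
  \<open>y \<le> t e\<close>; such a \<open>t\<close> exists because \<open>e\<close> is an order unit, and the infimum is attained
  because \<open>P\<close> is closed (\<open>gauge_le_iff\<close>).  Subadditivity of the gauge turns the cone metric \<open>p\<close>
  into the real metric \<open>\<lambda>x y. gauge (p x y)\<close>.  Every interior point dominates a multiple \<open>\<epsilon> e\<close> with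
  \<open>\<epsilon> > 0\<close>, which is itself an interior point, so both distances have the same
  convergent sequences and the same Cauchy sequences (\<open>eventually_ll_iff_gauge\<close>), and completeness transfers.

  The condition on \<open>\<phi>\<close> implies that \<open>T\<close> contracts the real metric.  Since the scalarization of
  \<open>\<phi> e\<close> is below 1, there is \<open>k \<in> [0, 1)\<close> with \<open>\<phi> e \<le> k e\<close>.  If \<open>p x y \<le> r e\<close>, then monotonicity
  gives \<open>p (T x) (T y) \<le> \<phi> (r e) \<le> r \<phi> e \<le> k r e\<close>, and \<open>r = gauge (p x y)\<close> is
  an admissible choice.  Banach's theorem yields the fixed point \<open>u\<close>, and the iterates converge to it
  because their distance to \<open>u\<close> is at most \<open>k\<^sup>n\<close> times the initial one.
\<close>

section \<open>Continuity of the vector space operations\<close>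

lemma continuous_on_scaleR_tvs:
  fixes g :: "'b::topological_space \<Rightarrow> 'e::topological_real_vector"
  assumes "continuous_on A f" and "continuous_on A g"
  shows "continuous_on A (\<lambda>x. f x *\<^sub>R g x)"
  unfolding continuous_on_def
proof
  fix a assume "a \<in> A"
  then have "(f \<longlongrightarrow> f a) (at a within A)" and "(g \<longlongrightarrow> g a) (at a within A)"
    using assms by (auto simp: continuous_on_def)
  then have "filterlim (\<lambda>x. (f x, g x)) (nhds (f a) \<times>\<^sub>F nhds (g a)) (at a within A)"
    by (rule filterlim_Pair)
  from filterlim_compose[OF tendsto_scaleR_nhds this]
  show "((\<lambda>x. f x *\<^sub>R g x) \<longlongrightarrow> f a *\<^sub>R g a) (at a within A)"
    by simp
qed

lemma continuous_on_diff_tvs: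
  fixes f g :: "'b::topological_space \<Rightarrow> 'e::topological_real_vector"
  assumes "continuous_on A f" and "continuous_on A g"
  shows "continuous_on A (\<lambda>x. f x - g x)"
  using assms unfolding continuous_on_def by (auto intro: tendsto_diff)

section \<open>The gauge of an order unit\<close>

locale cone_order_unit =
  fixes P :: "'e::topological_real_vector set" and e :: 'e
  assumes tvs_cone: "tvs_cone P" and interior_unit: "e \<in> interior P"
begin

lemma cone_add: "x \<in> P \<Longrightarrow> y \<in> P \<Longrightarrow> x + y \<in> P"
  using tvs_cone by (simp add: tvs_cone_def)

lemma cone_scale: "x \<in> P \<Longrightarrow> 0 \<le> c \<Longrightarrow> c *\<^sub>R x \<in> P"
  using tvs_cone by (simp add: tvs_cone_def mem_cone)

lemma unit_mem: "e \<in> P"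
  using interior_unit interior_subset by blast

lemma cone_zero: "0 \<in> P"
  using cone_scale[OF unit_mem, of 0] by simp

lemma cone_antisym: "x \<in> P \<Longrightarrow> - x \<in> P \<Longrightarrow> x = 0"
  using tvs_cone unfolding tvs_cone_def by (metis IntI empty_iff image_eqI insert_iff minus_minus)

lemma cone_le_trans: "cone_le P x y \<Longrightarrow> cone_le P y z \<Longrightarrow> cone_le P x z"
  using cone_add[of "z - y" "y - x"] by (simp add: cone_le_def)

lemma cone_le_add: "cone_le P x y \<Longrightarrow> cone_le P x' y' \<Longrightarrow> cone_le P (x + x') (y + y')"
  using cone_add[of "y - x" "y' - x'"] by (simp add: cone_le_def algebra_simps)

lemma cone_le_scale: "cone_le P x y \<Longrightarrow> 0 \<le> c \<Longrightarrow> cone_le P (c *\<^sub>R x) (c *\<^sub>R y)"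
  using cone_scale[of "y - x" c] by (simp add: cone_le_def scaleR_right_diff_distrib)

lemma unit_multiples_mono: "s \<le> t \<Longrightarrow> cone_le P (s *\<^sub>R e) (t *\<^sub>R e)"
  using cone_scale[OF unit_mem, of "t - s"] by (simp add: cone_le_def scaleR_left_diff_distrib)

text \<open>The translate of the interior by an element of \<open>P\<close> is an open subset of \<open>P\<close>.\<close>

lemma interior_add_cone:
  assumes "x \<in> interior P" and "y \<in> P"
  shows "x + y \<in> interior P"
proof -
  have "open ((\<lambda>z. z - y) -` interior P)"
    by (intro open_vimage continuous_on_diff_tvs continuous_on_id continuous_on_const) simp
  moreover have "(\<lambda>z. z - y) -` interior P \<subseteq> P"
  proof
    fix z assume "z \<in> (\<lambda>z. z - y) -` interior P"
    then have "z - y \<in> P"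
      using interior_subset by auto
    from cone_add[OF this assms(2)] show "z \<in> P"
      by simp
  qed
  ultimately show ?thesis
    using assms(1) by (auto intro: interiorI)
qed

lemma interior_scale:
  assumes "x \<in> interior P" and "0 < c"
  shows "c *\<^sub>R x \<in> interior P"
proof -
  have "open ((\<lambda>z. inverse c *\<^sub>R z) -` interior P)"
    by (intro open_vimage continuous_on_scaleR_tvs continuous_on_id continuous_on_const) simp
  moreover have "(\<lambda>z. inverse c *\<^sub>R z) -` interior P \<subseteq> P"
  proof
    fix z assume "z \<in> (\<lambda>z. inverse c *\<^sub>R z) -` interior P"
    then have "inverse c *\<^sub>R z \<in> P"
      using interior_subset by auto
    from cone_scale[OF this, of c] show "z \<in> P"
      using assms(2) by simp
  qed
  ultimately show ?thesis
    using assms by (auto intro: interiorI)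
qed

text \<open>Moving from an interior point in an arbitrary direction stays in the interior for a while:
  this is what makes \<open>e\<close> an order unit, and what puts a multiple of \<open>e\<close> below every interior point.\<close>

lemma interior_absorbs:
  assumes "x \<in> interior P"
  obtains \<delta> :: real where "0 < \<delta>" and "x - \<delta> *\<^sub>R y \<in> interior P"
proof -
  have "open ((\<lambda>r::real. x - r *\<^sub>R y) -` interior P)"
    by (intro open_vimage continuous_on_diff_tvs continuous_on_scaleR_tvs
        continuous_on_id continuous_on_const) simp
  moreover have "0 \<in> (\<lambda>r::real. x - r *\<^sub>R y) -` interior P"
    using assms by simp
  ultimately obtain d where d: "0 < d" "ball 0 d \<subseteq> (\<lambda>r::real. x - r *\<^sub>R y) -` interior P"
    by (meson open_contains_ball)
  have "d / 2 \<in> ball 0 d"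
    using d(1) by simp
  then have "x - (d / 2) *\<^sub>R y \<in> interior P"
    using d(2) by blast
  with d(1) show thesis
    by (intro that[of "d / 2"]) auto
qed

lemma unit_dominates:
  obtains t :: real where "0 \<le> t" and "cone_le P y (t *\<^sub>R e)"
proof -
  obtain \<delta> :: real where "0 < \<delta>" and "e - \<delta> *\<^sub>R y \<in> interior P"
    using interior_absorbs[OF interior_unit] .
  then have "inverse \<delta> *\<^sub>R (e - \<delta> *\<^sub>R y) \<in> P"
    using interior_subset by (intro cone_scale) auto
  then have "cone_le P y (inverse \<delta> *\<^sub>R e)"
    using \<open>0 < \<delta>\<close> by (simp add: cone_le_def scaleR_right_diff_distrib)
  with \<open>0 < \<delta>\<close> show thesis
    by (intro that[of "inverse \<delta>"]) auto
qed

text \<open>In a nonzero space this agrees on \<open>P\<close> with the scalarization function.  Admitting only nonnegative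
  \<open>t\<close> bounds the set below in the space \<open>{0}\<close> as well.\<close>

definition gauge :: "'e \<Rightarrow> real" where
  "gauge y = Inf {t. 0 \<le> t \<and> cone_le P y (t *\<^sub>R e)}"

lemma gauge_nonneg: "0 \<le> gauge y"
  unfolding gauge_def using unit_dominates[of y] by (intro cInf_greatest) auto

lemma le_gauge_unit: "cone_le P y (gauge y *\<^sub>R e)"
proof -
  let ?S = "{t. 0 \<le> t \<and> cone_le P y (t *\<^sub>R e)}"
  have "closed ({0..} \<inter> (\<lambda>t. t *\<^sub>R e - y) -` P)"
    using tvs_cone
    by (intro closed_Int closed_vimage continuous_on_diff_tvs continuous_on_scaleR_tvs
        continuous_on_id continuous_on_const) (auto simp: tvs_cone_def)
  also have "{0..} \<inter> (\<lambda>t. t *\<^sub>R e - y) -` P = ?S"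
    by (auto simp: cone_le_def)
  finally have "closed ?S" .
  moreover have "?S \<noteq> {}"
    using unit_dominates[of y] by blast
  moreover have "bdd_below ?S"
    by (intro bdd_belowI[of _ 0]) simp
  ultimately have "Inf ?S \<in> ?S"
    by (intro closed_contains_Inf)
  then show ?thesis
    by (simp add: gauge_def)
qed

lemma gauge_le_iff:
  assumes "0 \<le> r"
  shows "gauge y \<le> r \<longleftrightarrow> cone_le P y (r *\<^sub>R e)"
proof
  assume "gauge y \<le> r"
  then show "cone_le P y (r *\<^sub>R e)"
    using cone_le_trans[OF le_gauge_unit unit_multiples_mono] by blast
next
  assume "cone_le P y (r *\<^sub>R e)"
  with assms show "gauge y \<le> r"
    unfolding gauge_def by (intro cInf_lower bdd_belowI[of _ 0]) auto
qed

lemma gauge_add: "gauge (x + y) \<le> gauge x + gauge y"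
  using cone_le_add[OF le_gauge_unit[of x] le_gauge_unit[of y]]
  by (subst gauge_le_iff) (simp_all add: gauge_nonneg scaleR_left_distrib)

lemma gauge_mono: "cone_le P x y \<Longrightarrow> gauge x \<le> gauge y"
  using cone_le_trans[OF _ le_gauge_unit] by (simp add: gauge_le_iff gauge_nonneg)

lemma gauge_eq_0_iff:
  assumes "y \<in> P"
  shows "gauge y = 0 \<longleftrightarrow> y = 0"
proof -
  have "gauge y = 0 \<longleftrightarrow> gauge y \<le> 0"
    using gauge_nonneg[of y] by auto
  also have "\<dots> \<longleftrightarrow> - y \<in> P"
    by (simp add: gauge_le_iff cone_le_def)
  also have "\<dots> \<longleftrightarrow> y = 0"
    using cone_antisym[OF assms] cone_zero by auto
  finally show ?thesis .
qed

text \<open>The next two lemmas compare the neighbourhoods of 0 given by the interior points of \<open>P\<close> with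
  those given by the gauge, in either direction.\<close>

lemma gauge_less_imp_ll:
  assumes "cone_ll P 0 c"
  obtains \<epsilon> where "0 < \<epsilon>" and "\<And>y. gauge y < \<epsilon> \<Longrightarrow> cone_ll P y c"
proof -
  have "c \<in> interior P"
    using assms by (simp add: cone_ll_def)
  then obtain \<epsilon> :: real where \<epsilon>: "0 < \<epsilon>" "c - \<epsilon> *\<^sub>R e \<in> interior P"
    by (rule interior_absorbs)
  have "cone_ll P y c" if "gauge y < \<epsilon>" for y
  proof -
    have "cone_le P y (\<epsilon> *\<^sub>R e)"
      using that \<epsilon>(1) gauge_le_iff[of \<epsilon> y] by simp
    with interior_add_cone[OF \<epsilon>(2)] show ?thesis
      unfolding cone_le_def cone_ll_def by fastforce
  qed
  with \<epsilon>(1) show thesis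
    by (rule that)
qed

lemma ll_imp_gauge_less:
  assumes "0 < \<epsilon>"
  shows "cone_ll P 0 ((\<epsilon> / 2) *\<^sub>R e)"
    and "cone_ll P y ((\<epsilon> / 2) *\<^sub>R e) \<Longrightarrow> gauge y < \<epsilon>"
proof -
  show "cone_ll P 0 ((\<epsilon> / 2) *\<^sub>R e)"
    using interior_scale[OF interior_unit, of "\<epsilon> / 2"] assms by (simp add: cone_ll_def)
next
  assume "cone_ll P y ((\<epsilon> / 2) *\<^sub>R e)"
  then have "cone_le P y ((\<epsilon> / 2) *\<^sub>R e)"
    using interior_subset by (auto simp: cone_ll_def cone_le_def)
  then have "gauge y \<le> \<epsilon> / 2"
    using gauge_le_iff[of "\<epsilon> / 2" y] assms by simp
  with assms show "gauge y < \<epsilon>"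
    by simp
qed

text \<open>Stated for an arbitrary filter, so that one lemma covers convergence (along the natural
  numbers) and the Cauchy property (along pairs of them).\<close>

lemma eventually_ll_iff_gauge:
  "(\<forall>c. cone_ll P 0 c \<longrightarrow> (\<forall>\<^sub>F i in F. cone_ll P (f i) c)) \<longleftrightarrow>
   (\<forall>\<epsilon>>0. \<forall>\<^sub>F i in F. gauge (f i) < \<epsilon>)"
proof safe
  fix \<epsilon> :: real
  assume "\<forall>c. cone_ll P 0 c \<longrightarrow> (\<forall>\<^sub>F i in F. cone_ll P (f i) c)" and "0 < \<epsilon>"
  then have "\<forall>\<^sub>F i in F. cone_ll P (f i) ((\<epsilon> / 2) *\<^sub>R e)"
    using ll_imp_gauge_less(1) by blast
  then show "\<forall>\<^sub>F i in F. gauge (f i) < \<epsilon>"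
    using ll_imp_gauge_less(2)[OF \<open>0 < \<epsilon>\<close>] by (rule eventually_mono)
next
  fix c
  assume small: "\<forall>\<epsilon>>0. \<forall>\<^sub>F i in F. gauge (f i) < \<epsilon>" and "cone_ll P 0 c"
  obtain \<epsilon> where "0 < \<epsilon>" and less: "\<And>y. gauge y < \<epsilon> \<Longrightarrow> cone_ll P y c"
    using gauge_less_imp_ll[OF \<open>cone_ll P 0 c\<close>] by blast
  have "\<forall>\<^sub>F i in F. gauge (f i) < \<epsilon>"
    using small \<open>0 < \<epsilon>\<close> by blast
  then show "\<forall>\<^sub>F i in F. cone_ll P (f i) c"
    using less by (rule eventually_mono)
qed

lemma cone_converges_iff_gauge:
  "cone_converges P p s x \<longleftrightarrow> (\<forall>\<epsilon>>0. \<exists>N. \<forall>n\<ge>N. gauge (p (s n) x) < \<epsilon>)"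
  using eventually_ll_iff_gauge[where F = sequentially and f = "\<lambda>n. p (s n) x"]
  by (simp add: cone_converges_def eventually_sequentially)

lemma cone_Cauchy_iff_gauge:
  "cone_Cauchy P p s \<longleftrightarrow> (\<forall>\<epsilon>>0. \<exists>N. \<forall>n\<ge>N. \<forall>m\<ge>N. gauge (p (s n) (s m)) < \<epsilon>)"
  using eventually_ll_iff_gauge[where F = "sequentially \<times>\<^sub>F sequentially"
      and f = "\<lambda>(m, n). p (s n) (s m)"]
  by (simp add: cone_Cauchy_def eventually_prod_sequentially case_prod_beta')

text \<open>An infimum below 1 has a witness \<open>t < 1\<close> in the set.  It may be negative, while a contraction
  constant is not, so \<open>max t 0\<close> takes its place.\<close>

lemma scalarization_less_1_imp:
  assumes "scalarization P e y < 1"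
  obtains k where "0 \<le> k" and "k < 1" and "cone_le P y (k *\<^sub>R e)"
proof -
  let ?S = "{t. cone_le P y (t *\<^sub>R e)}"
  have mem: "y \<in> (\<lambda>q. t *\<^sub>R e - q) ` P \<longleftrightarrow> cone_le P y (t *\<^sub>R e)" for t
  proof
    assume "cone_le P y (t *\<^sub>R e)"
    then show "y \<in> (\<lambda>q. t *\<^sub>R e - q) ` P"
      unfolding cone_le_def by (intro image_eqI[of _ _ "t *\<^sub>R e - y"]) auto
  qed (auto simp: cone_le_def)
  have "Inf ?S < 1"
    using assms by (simp add: scalarization_def mem)
  moreover have "?S \<noteq> {}"
    using unit_dominates[of y] by blast
  ultimately obtain t where "t < 1" and t: "cone_le P y (t *\<^sub>R e)"
    using cInf_greatest[of ?S 1] by (metis mem_Collect_eq not_le)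
  moreover have "cone_le P y (max t 0 *\<^sub>R e)"
    using cone_le_trans[OF t unit_multiples_mono] by simp
  ultimately show thesis
    by (intro that[of "max t 0"]) auto
qed

end

section \<open>The real metric of a cone metric\<close>

locale cone_metric_with_unit =
  tvs_cone_metric_space P X p + cone_order_unit P e
  for P :: "'e::{locally_convex_space, t2_space} set"
    and X :: "'a set" and p :: "'a \<Rightarrow> 'a \<Rightarrow> 'e" and e :: 'e
begin

text \<open>The value 0 outside \<open>X\<close> is arbitrary; it makes the distance symmetric and nonnegative everywhere.\<close>

definition gauge_dist :: "'a \<Rightarrow> 'a \<Rightarrow> real" where
  "gauge_dist x y = (if x \<in> X \<and> y \<in> X then gauge (p x y) else 0)"

lemma gauge_dist_eq: "x \<in> X \<Longrightarrow> y \<in> X \<Longrightarrow> gauge_dist x y = gauge (p x y)"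
  by (simp add: gauge_dist_def)

sublocale gd: Metric_space X gauge_dist
proof
  show "0 \<le> gauge_dist x y" for x y
    by (simp add: gauge_dist_def gauge_nonneg)
  show "gauge_dist x y = gauge_dist y x" for x y
    by (simp add: gauge_dist_def commute)
  show "gauge_dist x y = 0 \<longleftrightarrow> x = y" if "x \<in> X" "y \<in> X" for x y
    using that nonneg[of x y] gauge_eq_0_iff[of "p x y"] eq_0_iff[of x y]
    by (simp add: gauge_dist_eq cone_le_def)
  show "gauge_dist x z \<le> gauge_dist x y + gauge_dist y z" if "x \<in> X" "y \<in> X" "z \<in> X" for x y z
  proof -
    have "gauge (p x z) \<le> gauge (p x y + p y z)"
      using that by (intro gauge_mono triangle)
    also have "\<dots> \<le> gauge (p x y) + gauge (p y z)"
      by (rule gauge_add)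
    finally show ?thesis
      using that by (simp add: gauge_dist_eq)
  qed
qed

lemma mcomplete_if_cone_complete:
  assumes "cone_complete P X p"
  shows "gd.mcomplete"
  unfolding gd.mcomplete_def
proof (intro allI impI)
  fix s assume s: "gd.MCauchy s"
  then have X: "range s \<subseteq> X"
    by (simp add: gd.MCauchy_def)
  then have [simp]: "s n \<in> X" for n
    by blast
  have "cone_Cauchy P p s"
    using s by (simp add: gd.MCauchy_def cone_Cauchy_iff_gauge gauge_dist_eq)
  with assms X obtain x where "x \<in> X" and "cone_converges P p s x"
    unfolding cone_complete_def by blast
  then show "\<exists>x. limitin gd.mtopology s x sequentially"
    by (intro exI[of _ x])
      (simp add: gd.limit_metric_sequentially cone_converges_iff_gauge gauge_dist_eq)
qed

text \<open>Since \<open>p x y\<close> lies below the point of the ray through \<open>e\<close> given by its gauge, a bound for the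
  monotone \<open>\<phi>\<close> on that ray bounds \<open>\<phi> (p x y)\<close>.\<close>

lemma gauge_dist_contraction:
  assumes T: "T \<in> X \<rightarrow> X"
    and contr: "\<And>x y. x \<in> X \<Longrightarrow> y \<in> X \<Longrightarrow> cone_le P (p (T x) (T y)) (\<phi> (p x y))"
    and mono: "monotone_on P (cone_le P) (cone_le P) \<phi>"
    and ray: "\<And>r::real. r \<ge> 0 \<Longrightarrow> cone_le P (\<phi> (r *\<^sub>R e)) (r *\<^sub>R \<phi> e)"
    and k: "0 \<le> k" "cone_le P (\<phi> e) (k *\<^sub>R e)"
    and xy: "x \<in> X" "y \<in> X"
  shows "gauge_dist (T x) (T y) \<le> k * gauge_dist x y"
proof -
  define r where "r = gauge (p x y)"
  have r: "0 \<le> r" "cone_le P (p x y) (r *\<^sub>R e)"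
    by (simp_all add: r_def gauge_nonneg le_gauge_unit)
  have "p x y \<in> P"
    using nonneg[OF xy] by (simp add: cone_le_def)
  then have "cone_le P (\<phi> (p x y)) (\<phi> (r *\<^sub>R e))"
    using r by (intro monotone_onD[OF mono] cone_scale unit_mem)
  then have "cone_le P (p (T x) (T y)) (r *\<^sub>R k *\<^sub>R e)"
    using contr[OF xy] ray[OF r(1)] cone_le_scale[OF k(2) r(1)] by (meson cone_le_trans)
  then have "gauge (p (T x) (T y)) \<le> r * k"
    using r(1) k(1) by (simp add: gauge_le_iff)
  moreover have "T x \<in> X" "T y \<in> X"
    using T xy by auto
  ultimately show ?thesis
    using xy by (simp add: gauge_dist_eq r_def mult.commute)
qed

end

section \<open>Iterates of a contraction\<close>

lemma (in Metric_space) dist_iterates_to_fixpoint_le: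
  assumes f: "f \<in> M \<rightarrow> M" and "0 \<le> k"
    and con: "\<And>x y. \<lbrakk>x \<in> M; y \<in> M\<rbrakk> \<Longrightarrow> d (f x) (f y) \<le> k * d x y"
    and u: "u \<in> M" "f u = u" and x: "x \<in> M"
  shows "(f ^^ n) x \<in> M \<and> d ((f ^^ n) x) u \<le> k ^ n * d x u"
proof (induction n)
  case 0
  then show ?case
    using x by simp
next
  case (Suc n)
  then have "d (f ((f ^^ n) x)) u \<le> k * d ((f ^^ n) x) u"
    using con[of "(f ^^ n) x" u] u by simp
  also have "\<dots> \<le> k * (k ^ n * d x u)"
    using Suc \<open>0 \<le> k\<close> by (intro mult_left_mono) auto
  finally show ?case
    using Suc f by auto
qed

lemma (in Metric_space) iterates_tendsto_fixpoint:
  assumes "f \<in> M \<rightarrow> M" and k: "0 \<le> k" "k < 1"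
    and "\<And>x y. \<lbrakk>x \<in> M; y \<in> M\<rbrakk> \<Longrightarrow> d (f x) (f y) \<le> k * d x y"
    and "u \<in> M" "f u = u" and "x \<in> M" and "0 < \<epsilon>"
  shows "\<exists>N. \<forall>n\<ge>N. (f ^^ n) x \<in> M \<and> d ((f ^^ n) x) u < \<epsilon>"
proof -
  have "(\<lambda>n. k ^ n * d x u) \<longlonglongrightarrow> 0"
    using k by (intro tendsto_mult_left_zero LIMSEQ_realpow_zero)
  then have "\<forall>\<^sub>F n in sequentially. k ^ n * d x u < \<epsilon>"
    using \<open>0 < \<epsilon>\<close> by (rule order_tendstoD)
  then obtain N where N: "\<And>n. n \<ge> N \<Longrightarrow> k ^ n * d x u < \<epsilon>"
    by (auto simp: eventually_sequentially)
  have "(f ^^ n) x \<in> M \<and> d ((f ^^ n) x) u < \<epsilon>" if "n \<ge> N" for n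
    using dist_iterates_to_fixpoint_le[OF assms(1) k(1) assms(4-7), of n] N[OF that] by linarith
  then show ?thesis
    by blast
qed

section \<open>The fixed point theorem\<close>

theorem proposition32:
  fixes P :: "'e::{locally_convex_space, t2_space} set"
    and X :: "'a set"
    and p :: "'a \<Rightarrow> 'a \<Rightarrow> 'e"
    and e :: 'e
    and T :: "'a \<Rightarrow> 'a"
    and \<phi> :: "'e \<Rightarrow> 'e"
  assumes "tvs_cone_metric_space P X p"
    and "cone_complete P X p"
    and "e \<in> interior P"
    and "T \<in> X \<rightarrow> X"
    and "\<phi> \<in> P \<rightarrow> P"
    and "\<And>x y. \<lbrakk>x \<in> X; y \<in> X\<rbrakk> \<Longrightarrow> cone_le P (p (T x) (T y)) (\<phi> (p x y))"
    and "monotone_on P (cone_le P) (cone_le P) \<phi>"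
    and "\<And>r::real. r \<ge> 0 \<Longrightarrow> cone_le P (\<phi> (r *\<^sub>R e)) (r *\<^sub>R \<phi> e)"
    and "scalarization P e (\<phi> e) < 1"
  shows "\<exists>u\<in>X. T u = u \<and> (\<forall>v\<in>X. T v = v \<longrightarrow> v = u) \<and>
           (\<forall>x\<in>X. cone_converges P p (\<lambda>n. (T ^^ n) x) u)"
proof -
  interpret cone_metric_with_unit P X p e
    using assms(1,3) tvs_cone_metric_space.tvs_cone[OF assms(1)]
    by (intro cone_metric_with_unit.intro cone_order_unit.intro)
  obtain k where k: "0 \<le> k" "k < 1" "cone_le P (\<phi> e) (k *\<^sub>R e)"
    using scalarization_less_1_imp[OF assms(9)] by blast
  have con: "gauge_dist (T x) (T y) \<le> k * gauge_dist x y" if "x \<in> X" "y \<in> X" for x y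
    using assms(4,6,7,8) k(1,3) that by (rule gauge_dist_contraction)
  obtain u where u: "u \<in> X" "T u = u"
    using gd.Banach_fixedpoint_thm[OF mcomplete_if_cone_complete[OF assms(2)] nonempty assms(4) k(2) con]
    by blast
  have "v = u" if "v \<in> X" "T v = v" for v
    using gd.contraction_imp_unique_fixpoint[OF that(2) u(2) assms(4) k(2) con that(1) u(1)] .
  moreover have "cone_converges P p (\<lambda>n. (T ^^ n) x) u" if "x \<in> X" for x
    unfolding cone_converges_iff_gauge
  proof (intro allI impI)
    fix \<epsilon> :: real assume "0 < \<epsilon>"
    from gd.iterates_tendsto_fixpoint[OF assms(4) k(1,2) con u that this]
    show "\<exists>N. \<forall>n\<ge>N. gauge (p ((T ^^ n) x) u) < \<epsilon>"
      using u(1) gauge_dist_eq by metis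
  qed
  ultimately show ?thesis
    using u by blast
qed

end
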